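(* Let $(M_n)_{n\ge0}$ be an increasing sequence of positive real numbers with $M_0=1$, which satisfies (mg) and $(\star)$. Let $m_0=(m_0(n))_{n\ge0}$ and $m_1=(m_1(n))_{n\ge0}$ be $(M_n)$-sequences of orders $s_0,s_1\ge0$, respectively. Let $K\ge1$, let $P_1,\dots,P_K$ be polynomials in one variable with complex coefficients, and put $$P(\partial_{m_0,t},\partial_{m_1,z})=\partial_{m_0,t}^{K}-\sum_{j=1}^KP_j(\partial_{m_1,z})\partial_{m_0,t}^{K-j}.$$ Let $k_1$ be the first positive slope of the Newton polygon associated with $P$, and assume $1/k_1>0$. Let $\hat f(t,z)$ be a formal power series of $(M_n)$-order $1/k_1$. Then the formal solution $\hat u(t,z)$ of the Cauchy problem $$P(\partial_{m_0,t},\partial_{m_1,z})u(t,z)=\hat f(t,z),\qquad \partial_{m_0,t}^ju(0,z)=0,\quad j=0,\dots,K-1,$$ is of $(M_n)$-order $1/k_1$.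
   Context: Here $t,z$ are one-dimensional complex variables; $D_R=\{z\in\mathbb{C}:|z|<R\}$ and $\mathcal{O}(D_R)$ is the set of holomorphic functions on $D_R$. A sequence $(M_n)_{n\ge 0}$ of positive reals with $M_0=1$ satisfies (mg) if there is $B>0$ with $M_{n+k}\le B^{n+k}M_nM_k$ for all $n,k\ge0$; it satisfies $(\star)$ if there is $b>0$ with $M_{n+k}\ge b^{n+k}M_nM_k$ for all $n,k\ge0$. A sequence of positive reals $(m(n))_{n\ge0}$ is an $(M_n)$-sequence of order $s\in\mathbb{R}$ if there are $\mathfrak{a},\mathfrak{A}>0$ with $\mathfrak{a}^n(M_n)^s\le m(n)\le\mathfrak{A}^n(M_n)^s$ for all $n\ge0$. For a sequence $m=(m(n))_{n\ge0}$ of positive reals, the $m$-differential operator is the operator on formal power series in $z$ given by $\partial_{m,z}\left(\sum_{n\ge0}\frac{u_n}{m(n)}z^n\right)=\sum_{n\ge0}\frac{u_{n+1}}{m(n)}z^n$; it acts with the other variable as a parameter (coefficientwise). A formal power series $\hat g(t,z)=\sum_{n\ge0}g_n(z)t^n$ is of $(M_n)$-order $s$ if, for some $R>0$, all $g_n\in\mathcal{O}(D_R)$ and for every $r\in(0,R)$ there are $A,B>0$ with $|g_n(z)|\le AB^n(M_n)^s$ for all $z\in D_r$ and $n\ge0$. (The radius $R$ may differ between $\hat f$ and $\hat u$.) Newton polygon: writing $P=\partial_{m_0,t}^K-\sum_{(j,\alpha)\in\Lambda}a_{j\alpha}\partial_{m_0,t}^{j}\partial_{m_1,z}^{\alpha}$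 with nonzero constants $a_{j\alpha}$ and finite $\Lambda\subseteq\{0,\dots,K-1\}\times\mathbb{N}_0$, the Newton polygon is the convex hull of $\Delta(Ks_0,-K)\cup\bigcup_{(j,\alpha)\in\Lambda}\Delta(js_0+\alpha s_1,-j)$, where $\Delta(a,b)=\{(x,y)\in\mathbb{R}^2:x\le a,\ y\ge b\}$, and its first positive slope $k_1$ is determined by $$\frac1{k_1}=\max\left\{0,\max_{(j,\alpha)\in\Lambda}\frac{s_0(j-K)+s_1\alpha}{K-j}\right\}.$$ The formal solution is the formal power series in $t$ (with coefficients power series in $z$) satisfying the equation and initial conditions formally. *)

theory Defs
  imports "HOL-Analysis.Analysis"
begin

definition cond_mg :: "(nat \<Rightarrow> real) \<Rightarrow> bool" where
  "cond_mg M \<longleftrightarrow> (\<exists>B>0. \<forall>n k. M (n + k) \<le> B ^ (n + k) * M n * M k)"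

definition cond_star :: "(nat \<Rightarrow> real) \<Rightarrow> bool" where
  "cond_star M \<longleftrightarrow> (\<exists>b>0. \<forall>n k. M (n + k) \<ge> b ^ (n + k) * M n * M k)"

definition seq_of_order :: "(nat \<Rightarrow> real) \<Rightarrow> real \<Rightarrow> (nat \<Rightarrow> real) \<Rightarrow> bool" where
  "seq_of_order M s m \<longleftrightarrow> (\<forall>n. 0 < m n) \<and>
     (\<exists>a>0. \<exists>A>0. \<forall>n. a ^ n * M n powr s \<le> m n \<and> m n \<le> A ^ n * M n powr s)"

text \<open>
  A formal power series in \<open>t\<close> whose coefficients are formal power series in \<open>z\<close> has type
  \<^typ>\<open>complex fps fps\<close>: the outer variable is \<open>t\<close>, the inner one is \<open>z\<close>.

  The \<open>m\<close>-differential operator sends \<open>\<Sum> u\<^sub>n / m(n) z\<^sup>n\<close> to \<open>\<Sum> u\<^sub>n\<^sub>+\<^sub>1 / m(n) z\<^sup>n\<close>. In terms of the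
  plain coefficients \<open>c\<^sub>n = u\<^sub>n / m(n)\<close>, the \<open>n\<close>-th coefficient of the image is
  \<open>m(n+1) c\<^sub>n\<^sub>+\<^sub>1 / m(n)\<close>.
\<close>

definition mdiff :: "(nat \<Rightarrow> real) \<Rightarrow> complex fps \<Rightarrow> complex fps" where
  "mdiff m g = Abs_fps (\<lambda>n. of_real (m (Suc n) / m n) * fps_nth g (Suc n))"

definition mdiff_t :: "(nat \<Rightarrow> real) \<Rightarrow> complex fps fps \<Rightarrow> complex fps fps" where
  "mdiff_t m u = Abs_fps (\<lambda>n. fps_const (of_real (m (Suc n) / m n)) * fps_nth u (Suc n))"

definition mdiff_z :: "(nat \<Rightarrow> real) \<Rightarrow> complex fps fps \<Rightarrow> complex fps fps" where
  "mdiff_z m u = Abs_fps (\<lambda>n. mdiff m (fps_nth u n))"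

definition poly_op ::
    "complex poly \<Rightarrow> (complex fps fps \<Rightarrow> complex fps fps) \<Rightarrow> complex fps fps \<Rightarrow> complex fps fps" where
  "poly_op p D u = (\<Sum>\<alpha>\<le>degree p. fps_const (fps_const (coeff p \<alpha>)) * (D ^^ \<alpha>) u)"

text \<open>Only the polynomials \<open>P 1, \<dots>, P K\<close> are used below.\<close>

definition cauchy_op ::
    "nat \<Rightarrow> (nat \<Rightarrow> complex poly) \<Rightarrow> (nat \<Rightarrow> real) \<Rightarrow> (nat \<Rightarrow> real) \<Rightarrow> complex fps fps \<Rightarrow> complex fps fps"
  where
  "cauchy_op K P m0 m1 u =
     (mdiff_t m0 ^^ K) u - (\<Sum>j=1..K. poly_op (P j) (mdiff_z m1) ((mdiff_t m0 ^^ (K - j)) u))"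

definition formal_solution ::
    "nat \<Rightarrow> (nat \<Rightarrow> complex poly) \<Rightarrow> (nat \<Rightarrow> real) \<Rightarrow> (nat \<Rightarrow> real) \<Rightarrow>
     complex fps fps \<Rightarrow> complex fps fps \<Rightarrow> bool" where
  "formal_solution K P m0 m1 f u \<longleftrightarrow>
     cauchy_op K P m0 m1 u = f \<and> (\<forall>j<K. fps_nth ((mdiff_t m0 ^^ j) u) 0 = 0)"

text \<open>
  A coefficient \<open>g\<^sub>n\<close>, given as a formal power series in \<open>z\<close>, belongs to \<open>\<O>(D\<^sub>R)\<close> if it is the Taylor
  expansion at \<open>0\<close> of a (unique) holomorphic function \<open>G n\<close> on the disc of radius \<open>R\<close>.
\<close>

definition fps_of_order :: "(nat \<Rightarrow> real) \<Rightarrow> real \<Rightarrow> complex fps fps \<Rightarrow> bool" where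
  "fps_of_order M s g \<longleftrightarrow>
     (\<exists>R>0. \<exists>G.
        (\<forall>n. G n holomorphic_on ball 0 R \<and> G n has_fps_expansion fps_nth g n) \<and>
        (\<forall>r. 0 < r \<and> r < R \<longrightarrow>
          (\<exists>A>0. \<exists>B>0. \<forall>n. \<forall>z\<in>ball 0 r. norm (G n z) \<le> A * B ^ n * M n powr s)))"

definition quadrant :: "real \<times> real \<Rightarrow> (real \<times> real) set" where
  "quadrant p = {q. fst q \<le> fst p \<and> snd q \<ge> snd p}"

text \<open>
  The pairs \<open>(j, \<alpha>)\<close> for which \<open>\<partial>\<^sub>t\<^sup>j \<partial>\<^sub>z\<^sup>\<alpha>\<close> occurs in the sum with a nonzero coefficient;
  \<open>\<partial>\<^sub>t\<^sup>j\<close> is multiplied by the polynomial with index \<open>K - j\<close>.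
\<close>

definition op_support :: "nat \<Rightarrow> (nat \<Rightarrow> complex poly) \<Rightarrow> (nat \<times> nat) set" where
  "op_support K P = {(j, \<alpha>). j < K \<and> coeff (P (K - j)) \<alpha> \<noteq> 0}"

definition newton_polygon ::
    "real \<Rightarrow> real \<Rightarrow> nat \<Rightarrow> (nat \<Rightarrow> complex poly) \<Rightarrow> (real \<times> real) set" where
  "newton_polygon s0 s1 K P = convex hull
     (quadrant (real K * s0, - real K) \<union>
      (\<Union>(j, \<alpha>)\<in>op_support K P. quadrant (real j * s0 + real \<alpha> * s1, - real j)))"

definition edge_slope :: "(real \<times> real) set \<Rightarrow> real \<Rightarrow> bool" where
  "edge_slope N k \<longleftrightarrow> (\<exists>e. e edge_of N \<and>
     (\<exists>a\<in>e. \<exists>b\<in>e. fst a \<noteq> fst b \<and> k = (snd b - snd a) / (fst b - fst a)))"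

text \<open>
  If a Newton polygon has no edge of positive slope, its first positive slope is infinite by
  convention; the following predicate then holds for no real number.
\<close>

definition first_positive_slope :: "(real \<times> real) set \<Rightarrow> real \<Rightarrow> bool" where
  "first_positive_slope N k \<longleftrightarrow>
     0 < k \<and> edge_slope N k \<and> (\<forall>k'. 0 < k' \<and> edge_slope N k' \<longrightarrow> k \<le> k')"

lemma finite_op_support: "finite (op_support K P)"
proof -
  have "op_support K P \<subseteq> (\<Union>j\<in>{..<K}. Pair j ` {..degree (P (K - j))})"
    by (auto simp: op_support_def image_iff le_degree)
  then show ?thesis
    by (rule finite_subset) auto
qed

lemma quadrant_hull_translate:
  fixes S :: "(real \<times> real) set"
  assumes q: "q \<in> convex hull (\<Union>p\<in>S. quadrant p)" and x: "fst q' \<le> fst q" "snd q' \<ge> snd q"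
  shows "q' \<in> convex hull (\<Union>p\<in>S. quadrant p)"
proof -
  let ?U = "\<Union>p\<in>S. quadrant p"
  have "(\<lambda>x. (q' - q) + x) ` ?U \<subseteq> ?U"
    using x by (force simp: quadrant_def)
  then have "convex hull ((\<lambda>x. (q' - q) + x) ` ?U) \<subseteq> convex hull ?U"
    by (rule hull_mono)
  moreover have "(q' - q) + q \<in> (\<lambda>x. (q' - q) + x) ` (convex hull ?U)"
    using q by blast
  ultimately show ?thesis
    unfolding convex_hull_translation by auto
qed

lemma first_positive_slope_quadrants:
  fixes S :: "(real \<times> real) set" and v :: "real \<times> real"
  assumes fin: "finite S" and S: "\<And>p. p \<in> S \<Longrightarrow> snd v < snd p"
  defines "\<sigma> \<equiv> Max (insert 0 ((\<lambda>p. (fst p - fst v) / (snd p - snd v)) ` S))"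
  shows "first_positive_slope (convex hull (\<Union>p\<in>insert v S. quadrant p)) k \<longleftrightarrow>
         0 < k \<and> 1 / k = \<sigma>"
proof -
  define N where "N = convex hull (\<Union>p\<in>insert v S. quadrant p)"
  have \<sigma>0: "0 \<le> \<sigma>" and \<sigma>S: "\<And>p. p \<in> S \<Longrightarrow> (fst p - fst v) / (snd p - snd v) \<le> \<sigma>"
    unfolding \<sigma>_def using fin by (auto intro!: Max_ge)
  have \<sigma>S': "fst p - fst v \<le> \<sigma> * (snd p - snd v)" if "p \<in> S" for p
    using \<sigma>S[OF that] S[OF that] by (simp add: field_simps)
  have cN: "convex N"
    by (simp add: N_def)
  have sub: "(\<Union>p\<in>insert v S. quadrant p) \<subseteq> N"
    unfolding N_def by (rule hull_subset)
  have vN: "v \<in> N" and SN: "S \<subseteq> N"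
    using sub by (auto simp: quadrant_def)
  have mono: "q' \<in> N" if "q \<in> N" "fst q' \<le> fst q" "snd q' \<ge> snd q" for q q'
    using quadrant_hull_translate that unfolding N_def by blast
  have A: "snd v \<le> snd q" if "q \<in> N" for q
  proof -
    have "N \<subseteq> {q. (0, 1) \<bullet> q \<ge> snd v}"
      unfolding N_def by (rule hull_minimal)
        (use S in \<open>fastforce simp: quadrant_def inner_prod_def\<close>, rule convex_halfspace_ge)
    then show ?thesis using that by (auto simp: inner_prod_def)
  qed
  have B: "fst q - fst v \<le> \<sigma> * (snd q - snd v)" if "q \<in> N" for q
  proof -
    have "(1, - \<sigma>) \<bullet> q \<le> fst v - \<sigma> * snd v" if "q \<in> quadrant p" "p \<in> insert v S" for q p
    proof -
      have "fst p - fst v \<le> \<sigma> * (snd p - snd v)"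
        using that \<sigma>S' by auto
      moreover have "\<sigma> * snd p \<le> \<sigma> * snd q" "fst q \<le> fst p"
        using that \<sigma>0 by (auto simp: quadrant_def intro: mult_left_mono)
      ultimately show ?thesis
        by (simp add: inner_prod_def algebra_simps)
    qed
    then have "N \<subseteq> {q. (1, - \<sigma>) \<bullet> q \<le> fst v - \<sigma> * snd v}"
      unfolding N_def by (intro hull_minimal convex_halfspace_le) blast
    then show ?thesis using that by (auto simp: inner_prod_def algebra_simps)
  qed
  have ex: "edge_slope N (1 / \<sigma>)" if \<sigma>: "0 < \<sigma>"
  proof -
    have "\<sigma> \<in> insert 0 ((\<lambda>p. (fst p - fst v) / (snd p - snd v)) ` S)"
      unfolding \<sigma>_def using fin by (intro Max_in) auto
    with \<sigma> obtain p where p: "p \<in> S" "\<sigma> = (fst p - fst v) / (snd p - snd v)"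
      by auto
    have p1: "fst p - fst v = \<sigma> * (snd p - snd v)"
      using p S[OF p(1)] by simp
    have p2: "fst v < fst p"
      using p1 \<sigma> S[OF p(1)] by (metis diff_gt_0_iff_gt mult_pos_pos)
    define H :: "(real \<times> real) set" where "H = {q. (1, - \<sigma>) \<bullet> q = fst v - \<sigma> * snd v}"
    have face: "(N \<inter> H) face_of N"
      unfolding H_def using B
      by (intro face_of_Int_supporting_hyperplane_le cN)
        (auto simp: inner_prod_def algebra_simps)
    have vp: "v \<in> N \<inter> H" "p \<in> N \<inter> H"
      using vN SN p(1) p1 by (auto simp: H_def inner_prod_def algebra_simps)
    have "aff_dim (N \<inter> H) \<le> aff_dim H"
      by (rule aff_dim_subset) auto
    also have "aff_dim H = 1"
      unfolding H_def by (subst aff_dim_hyperplane) (auto simp: zero_prod_def)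
    finally have "aff_dim (N \<inter> H) \<le> 1" .
    moreover have "aff_dim {v, p} \<le> aff_dim (N \<inter> H)"
      by (rule aff_dim_subset) (use vp in auto)
    ultimately have "(N \<inter> H) edge_of N"
      using face p2 by (auto simp: edge_of_def split: if_splits)
    moreover have "1 / \<sigma> = (snd p - snd v) / (fst p - fst v)"
      using p by simp
    ultimately show ?thesis
      unfolding edge_slope_def using vp p2 by (metis less_irrefl)
  qed
  have lower: "1 / k \<le> \<sigma>" if k: "0 < k" and e: "edge_slope N k" for k
  proof (rule ccontr)
    assume "\<not> 1 / k \<le> \<sigma>"
    then have k\<sigma>: "k * \<sigma> < 1"
      using k by (simp add: field_simps)
    obtain e a b where e: "e face_of N" "aff_dim e = 1" and ab: "a \<in> e" "b \<in> e" "fst a \<noteq> fst b"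
      and kab: "k = (snd b - snd a) / (fst b - fst a)"
      using e by (auto simp: edge_slope_def edge_of_def)
    have abN: "a \<in> N" "b \<in> N"
      using e(1) ab face_of_imp_subset by auto
    define h where "h q = (snd q - snd v) - k * (fst q - fst v)" for q
    have hab: "snd b - snd a = k * (fst b - fst a)"
      using kab ab(3) by simp
    have h_ge: "(1 - k * \<sigma>) * (snd q - snd v) \<le> h q" if "q \<in> N" for q
      using mult_left_mono[OF B[OF that], of k] k by (simp add: h_def algebra_simps)
    have h_eq: "h b = h a"
      using hab by (simp add: h_def algebra_simps)
    have h_line: "h (a + t *\<^sub>R (b - a)) = h a" for t
    proof -
      have "h (a + t *\<^sub>R (b - a)) = h a + t * ((snd b - snd a) - k * (fst b - fst a))"
        by (simp add: h_def algebra_simps)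
      then show ?thesis using hab by simp
    qed
    have "snd a \<noteq> snd b"
      using hab ab(3) k by auto
    then obtain w where "w \<in> N" "h w = h a" "snd v < snd w"
      using A[OF abN(1)] A[OF abN(2)] abN h_eq
      by (metis order_le_less)
    then have \<eta>: "0 < h a"
      using h_ge[of w] k\<sigma> by (smt (verit) mult_pos_pos)
    define c where "c = a + (1/2) *\<^sub>R (b - a)"
    have ce: "c \<in> e"
    proof -
      have "c = (1/2) *\<^sub>R a + (1/2) *\<^sub>R b"
        by (simp add: c_def prod_eq_iff field_simps)
      then show ?thesis
        using ab face_of_imp_convex[OF e(1)] by (auto intro: convexD)
    qed
    define d where "d = \<bar>fst b - fst a\<bar>"
    have d: "0 < d"
      using ab(3) by (simp add: d_def)
    define \<epsilon> where "\<epsilon> = d / (2 * (\<bar>fst c - fst v\<bar> + d))"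
    have \<epsilon>: "0 < \<epsilon>" "\<epsilon> * \<bar>fst c - fst v\<bar> \<le> d / 2"
    proof -
      have pos: "0 < \<bar>fst c - fst v\<bar> + d"
        using d by simp
      then show "0 < \<epsilon>"
        using d by (simp add: \<epsilon>_def)
      have "\<epsilon> * \<bar>fst c - fst v\<bar> \<le> \<epsilon> * (\<bar>fst c - fst v\<bar> + d)"
        using d \<open>0 < \<epsilon>\<close> by (intro mult_left_mono) auto
      also have "\<dots> = d / 2"
        using pos unfolding \<epsilon>_def by (simp only: times_divide_eq_left) (simp add: divide_simps)
      finally show "\<epsilon> * \<bar>fst c - fst v\<bar> \<le> d / 2" .
    qed
    define q where "q = c + \<epsilon> *\<^sub>R (c - v)"
    have hc: "h c = h a"
      unfolding c_def by (rule h_line)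
    have hq: "h q = h a + \<epsilon> * h a"
    proof -
      have "h q = h c + \<epsilon> * h c"
        by (simp add: q_def h_def algebra_simps)
      then show ?thesis using hc by simp
    qed
    define t where "t = 1/2 + \<epsilon> * (fst c - fst v) / (fst b - fst a)"
    define w where "w = a + t *\<^sub>R (b - a)"
    have "\<bar>\<epsilon> * (fst c - fst v) / (fst b - fst a)\<bar> \<le> 1/2"
    proof -
      have "\<bar>\<epsilon> * (fst c - fst v) / (fst b - fst a)\<bar> = \<epsilon> * \<bar>fst c - fst v\<bar> / d"
        using \<epsilon>(1) by (simp add: abs_mult d_def)
      also have "\<dots> \<le> (d / 2) / d"
        using \<epsilon>(2) d by (intro divide_right_mono) auto
      finally show ?thesis using d by simp
    qed
    then have t: "0 \<le> t" "t \<le> 1"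
      unfolding t_def by linarith+
    have "w = (1 - t) *\<^sub>R a + t *\<^sub>R b"
      by (simp add: w_def prod_eq_iff algebra_simps)
    then have wN: "w \<in> N"
      using t abN cN by (auto intro: convexD)
    have fw: "fst w = fst q"
    proof -
      have "t * (fst b - fst a) = (1/2) * (fst b - fst a) + \<epsilon> * (fst c - fst v)"
        using ab(3) by (simp add: t_def distrib_right)
      then show ?thesis
        by (simp add: w_def q_def c_def)
    qed
    have "h w < h q"
      using h_line[of t] hq \<eta> \<epsilon>(1) by (simp add: w_def)
    then have "snd w \<le> snd q"
      using fw by (simp add: h_def)
    then have qN: "q \<in> N"
      using mono[OF wN] fw by simp
    have "h v = 0" "0 < h q"
      using hq \<eta> \<epsilon>(1) by (simp add: h_def, simp add: add_pos_pos)
    then have "v \<noteq> q"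
      by auto
    moreover have "c = (1 - 1 / (1 + \<epsilon>)) *\<^sub>R v + (1 / (1 + \<epsilon>)) *\<^sub>R q"
      using \<epsilon>(1) by (simp add: q_def prod_eq_iff divide_simps) (simp add: algebra_simps)
    ultimately have "c \<in> open_segment v q"
      unfolding in_segment using \<epsilon>(1) by (intro conjI exI[of _ "1 / (1 + \<epsilon>)"]) auto
    then have ve: "v \<in> e"
      using face_ofD[OF e(1) _ vN qN ce] by blast
    have "collinear e"
      using e(2) by (simp add: collinear_aff_dim)
    then have "collinear {a, b, v}"
      by (rule collinear_subset) (use ab ve in auto)
    moreover have "a \<noteq> b"
      using ab(3) by auto
    ultimately have "v \<in> affine hull {a, b}"
      using collinear_3_affine_hull by blast
    then obtain x y where xy: "x + y = 1" "v = x *\<^sub>R a + y *\<^sub>R b"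
      by (auto simp: affine_hull_2)
    have x: "x = 1 - y" using xy(1) by simp
    have "v = a + y *\<^sub>R (b - a)"
      unfolding xy(2) x by (simp add: prod_eq_iff algebra_simps)
    then have "h v = h a"
      using h_line[of y] by simp
    then show False
      using \<eta> by (simp add: h_def)
  qed
  show ?thesis
    unfolding N_def[symmetric]
  proof
    assume fps: "first_positive_slope N k"
    then have k: "0 < k" "1 / k \<le> \<sigma>"
      using lower by (auto simp: first_positive_slope_def)
    then have \<sigma>: "0 < \<sigma>"
      by (meson divide_pos_pos less_le_trans zero_less_one)
    then have "k \<le> 1 / \<sigma>"
      using fps ex by (auto simp: first_positive_slope_def)
    then have "1 / k \<ge> \<sigma>"
      using k \<sigma> by (simp add: field_simps)
    with k show "0 < k \<and> 1 / k = \<sigma>" by simp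
  next
    assume k: "0 < k \<and> 1 / k = \<sigma>"
    then have \<sigma>: "0 < \<sigma>" and k\<sigma>: "k = 1 / \<sigma>" by auto
    have "k \<le> k'" if k': "0 < k'" "edge_slope N k'" for k'
      using lower[OF k'] k' \<sigma> by (simp add: k\<sigma> field_simps)
    then show "first_positive_slope N k"
      using ex[OF \<sigma>] k by (auto simp: first_positive_slope_def k\<sigma>)
  qed
qed

lemma first_positive_slope_newton_polygon:
  "first_positive_slope (newton_polygon s0 s1 K P) k \<longleftrightarrow>
     0 < k \<and>
     1 / k = Max (insert 0 ((\<lambda>(j, \<alpha>). (s0 * (real j - real K) + s1 * real \<alpha>) / (real K - real j))
                              ` op_support K P))"
proof -
  define v where "v = (real K * s0, - real K)"
  define g where "g = (\<lambda>(j, \<alpha>). (real j * s0 + real \<alpha> * s1, - real j))"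
  have N: "newton_polygon s0 s1 K P = convex hull (\<Union>p\<in>insert v (g ` op_support K P). quadrant p)"
    by (simp add: newton_polygon_def v_def g_def case_prod_unfold)
  have im: "(\<lambda>p. (fst p - fst v) / (snd p - snd v)) ` g ` op_support K P =
      (\<lambda>(j, \<alpha>). (s0 * (real j - real K) + s1 * real \<alpha>) / (real K - real j)) ` op_support K P"
    unfolding image_image
    by (rule image_cong) (auto simp: v_def g_def algebra_simps)
  show ?thesis
    unfolding N im[symmetric]
    by (rule first_positive_slope_quadrants)
      (use finite_op_support in \<open>auto simp: v_def g_def, auto simp: op_support_def\<close>)
qed

end

theory Submission
  imports Defs "HOL-Complex_Analysis.Complex_Analysis"
begin

text \<open>
  For the scaled coefficients \<open>U n \<beta> = m\<^sub>0(n) m\<^sub>1(\<beta>) u\<^sub>n\<^sub>,\<^sub>\<beta>\<close> the operators become index shifts, so \<open>U n \<beta>\<close> is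
  a sum over paths in the index lattice, ending at points \<open>(n - a, \<beta> + b)\<close>, of products of
  coefficients of \<open>P\<close> with values of the scaled right-hand side. There are only exponentially many
  paths. The slope condition gives \<open>s\<^sub>1 b \<le> \<tau> a\<close> with \<open>\<tau> = s\<^sub>0 + 1/k\<^sub>1\<close>. Since \<open>ln M\<close> is additive up to
  a linear error, this implies \<open>s\<^sub>1 ln M\<^sub>b \<le> \<tau> ln M\<^sub>a + O(a)\<close>, so the growth of the factor in \<open>\<beta> + b\<close> is paid for by the decrease from \<open>n\<close> to \<open>n - a\<close>.
\<close>

section \<open>The recursion for the scaled coefficients\<close>

function char_rec :: "nat \<Rightarrow> (nat \<Rightarrow> complex poly) \<Rightarrow> (nat \<Rightarrow> nat \<Rightarrow> complex) \<Rightarrow> nat \<Rightarrow> nat \<Rightarrow> complex" where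
  "char_rec K P F n \<beta> = (if n < K then 0 else F (n - K) \<beta> +
     (\<Sum>j=1..K. \<Sum>\<alpha>\<le>degree (P j). coeff (P j) \<alpha> * char_rec K P F (n - j) (\<beta> + \<alpha>)))"
  by pat_completeness auto
text \<open>Only the first index decreases, since \<open>n \<ge> K \<ge> j \<ge> 1\<close> in every
  recursive call; the second index may grow.\<close>

termination
  by (relation "Wellfounded.measure (\<lambda>(K, P, F, n, \<beta>). n)") auto

declare char_rec.simps [simp del]

text \<open>Every term on the right has a first index below \<open>n + K\<close> but possibly a
  larger second index, so the induction on the first index runs over all \<open>\<beta>\<close> at
  once. Writing the recurrence at \<open>n + K\<close> avoids truncated subtraction.\<close>

lemma char_rec_unique:
  assumes "\<And>n \<beta>. n < K \<Longrightarrow> U n \<beta> = 0"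
    and "\<And>n \<beta>. U (n + K) \<beta> = F n \<beta> +
      (\<Sum>j=1..K. \<Sum>\<alpha>\<le>degree (P j). coeff (P j) \<alpha> * U (n + K - j) (\<beta> + \<alpha>))"
  shows "U n \<beta> = char_rec K P F n \<beta>"
proof (induction n arbitrary: \<beta> rule: less_induct)
  case (less n)
  show ?case
  proof (cases "n < K")
    case True
    then show ?thesis
      by (simp add: assms(1) char_rec.simps)
  next
    case False
    have "(\<Sum>j=1..K. \<Sum>\<alpha>\<le>degree (P j). coeff (P j) \<alpha> * U (n - j) (\<beta> + \<alpha>)) =
        (\<Sum>j=1..K. \<Sum>\<alpha>\<le>degree (P j). coeff (P j) \<alpha> * char_rec K P F (n - j) (\<beta> + \<alpha>))"
      using False by (intro sum.cong refl) (simp add: less)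
    then show ?thesis
      using False assms(2)[of "n - K" \<beta>] by (subst char_rec.simps) simp
  qed
qed

text \<open>
  \<open>V\<close> bounds \<open>w\<close> at all endpoints reachable from \<open>(n, \<beta>)\<close>; quantifying over \<open>V\<close> makes the induction
  go through without summing over paths.
\<close>

lemma char_rec_bound:
  fixes w :: "nat \<Rightarrow> nat \<Rightarrow> real" and s \<tau> :: real
  assumes A: "0 \<le> A" and F: "\<And>n \<beta>. norm (F n \<beta>) \<le> A * w n \<beta>"
    and w: "\<And>n \<beta>. 0 \<le> w n \<beta>"
    and supp: "\<And>j \<alpha>. \<lbrakk>j \<in> {1..K}; coeff (P j) \<alpha> \<noteq> 0\<rbrakk> \<Longrightarrow> \<alpha> \<le> q * j \<and> s * real \<alpha> \<le> \<tau> * real j"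
    and \<tau>: "0 \<le> \<tau>" and K: "1 \<le> K"
    and Q: "1 + (\<Sum>j=1..K. \<Sum>\<alpha>\<le>degree (P j). norm (coeff (P j) \<alpha>)) \<le> Q"
    and V: "\<And>a b. \<lbrakk>a \<le> n; b \<le> q * a; s * real b \<le> \<tau> * real a\<rbrakk> \<Longrightarrow> w (n - a) (\<beta> + b) \<le> V"
  shows "norm (char_rec K P F n \<beta>) \<le> A * Q ^ n * V"
  using V
proof (induction n arbitrary: \<beta> rule: less_induct)
  case (less n)
  define S where "S = (\<Sum>j=1..K. \<Sum>\<alpha>\<le>degree (P j). norm (coeff (P j) \<alpha>))"
  have S: "0 \<le> S"
    unfolding S_def by (intro sum_nonneg) auto
  have Q1: "1 \<le> Q"
    using Q S unfolding S_def by linarith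
  have V0: "0 \<le> V"
    using less.prems[of 0 0] w[of n \<beta>] by simp
  show ?case
  proof (cases "n < K")
    case True
    then show ?thesis
      using A V0 Q1 by (simp add: char_rec.simps)
  next
    case False
    \<comment> \<open>The source term corresponds to the endpoint \<open>a = K\<close>,
      \<open>b = 0\<close>, which is admissible because \<open>0 \<le> \<tau>\<close>.\<close>
    have F': "norm (F (n - K) \<beta>) \<le> A * Q ^ (n - 1) * V"
    proof -
      have "norm (F (n - K) \<beta>) \<le> A * w (n - K) \<beta>"
        by (rule F)
      also have "\<dots> \<le> A * V"
        using less.prems[of K 0] False A \<tau> by (intro mult_left_mono) auto
      also have "\<dots> \<le> A * Q ^ (n - 1) * V"
        using A V0 Q1 one_le_power[OF Q1, of "n - 1"]
        by (intro mult_right_mono) (auto intro: mult_le_cancel_left1[THEN iffD2])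
      finally show ?thesis .
    qed
    have step: "norm (coeff (P j) \<alpha> * char_rec K P F (n - j) (\<beta> + \<alpha>))
        \<le> norm (coeff (P j) \<alpha>) * (A * Q ^ (n - 1) * V)" if j: "j \<in> {1..K}" for j \<alpha>
    proof (cases "coeff (P j) \<alpha> = 0")
      case c: False
      have j': "1 \<le> j" "j \<le> n"
        using j False by auto
      have "norm (char_rec K P F (n - j) (\<beta> + \<alpha>)) \<le> A * Q ^ (n - j) * V"
      proof (rule less.IH)
        show "n - j < n"
          using j' by simp
        fix a b assume ab: "a \<le> n - j" "b \<le> q * a" "s * real b \<le> \<tau> * real a"
        \<comment> \<open>Both endpoint constraints are additive, so prefixing the step
          \<open>(j, \<alpha>)\<close> to the displacement \<open>(a, b)\<close> gives an admissible
          displacement from \<open>(n, \<beta>)\<close>.\<close>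
        have "w (n - (j + a)) (\<beta> + (\<alpha> + b)) \<le> V"
          using supp[OF j c] ab j' by (intro less.prems) (auto simp: algebra_simps)
        then show "w (n - j - a) (\<beta> + \<alpha> + b) \<le> V"
          by (simp add: add.assoc)
      qed
      also have "\<dots> \<le> A * Q ^ (n - 1) * V"
        using A V0 Q1 j' by (intro mult_right_mono mult_left_mono power_increasing) auto
      finally show ?thesis
        by (simp add: norm_mult mult_left_mono)
    qed simp
    have "norm (char_rec K P F n \<beta>) \<le> norm (F (n - K) \<beta>) +
        (\<Sum>j=1..K. \<Sum>\<alpha>\<le>degree (P j). norm (coeff (P j) \<alpha> * char_rec K P F (n - j) (\<beta> + \<alpha>)))"
      using False by (subst char_rec.simps)
        (simp, intro norm_triangle_le add_mono order.refl sum_norm_le)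
    also have "\<dots> \<le> A * Q ^ (n - 1) * V +
        (\<Sum>j=1..K. \<Sum>\<alpha>\<le>degree (P j). norm (coeff (P j) \<alpha>) * (A * Q ^ (n - 1) * V))"
      by (intro add_mono F' sum_mono step)
    \<comment> \<open>Source and branches have total weight \<open>1 + S \<le> Q\<close>; this
      supplies the missing factor, as \<open>n \<ge> K \<ge> 1\<close> gives
      \<open>Q * Q ^ (n - 1) = Q ^ n\<close>.\<close>
    also have "\<dots> = (1 + S) * (A * Q ^ (n - 1) * V)"
      by (simp add: S_def sum_distrib_right distrib_right)
    also have "\<dots> \<le> Q * (A * Q ^ (n - 1) * V)"
      using Q A V0 Q1 by (intro mult_right_mono) (auto simp: S_def)
    also have "\<dots> = A * Q ^ n * V"
      using False K by (cases n) auto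
    finally show ?thesis .
  qed
qed

section \<open>Almost additive sequences\<close>

text \<open>
  The subtractive Euclidean algorithm: passing from \<open>(a, b)\<close> to \<open>(a - b, b)\<close> changes the left-hand side
  by at most \<open>c a b\<close>, which is at most the decrease of \<open>c (a\<^sup>2 + b\<^sup>2)\<close> when \<open>b \<le> a\<close>.
\<close>

lemma almost_additive_cross:
  fixes L :: "nat \<Rightarrow> real"
  assumes c: "\<And>n k. \<bar>L (n + k) - L n - L k\<bar> \<le> c * real (n + k)" and L0: "L 0 = 0"
  shows "real a * L b - real b * L a \<le> c * ((real a)\<^sup>2 + (real b)\<^sup>2)"
proof (induction "a + b" arbitrary: a b rule: less_induct)
  case less
  have "0 \<le> c"
    using c[of 1 0] L0 by simp
  consider "a = 0 \<or> b = 0" | "0 < b" "b \<le> a" | "0 < a" "a < b"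
    by linarith
  then show ?case
  proof cases
    case 1
    then show ?thesis
      using L0 \<open>0 \<le> c\<close> by auto
  next
    case 2
    define d where "d = a - b"
    have a: "a = d + b"
      using 2 by (simp add: d_def)
    have "real d * L b - real b * L d \<le> c * ((real d)\<^sup>2 + (real b)\<^sup>2)"
      using 2 by (intro less) (simp add: a)
    moreover have "real b * (L d + L b - L a) \<le> real b * (c * real a)"
      using c[of d b] by (intro mult_left_mono) (auto simp: a)
    \<comment> \<open>With \<open>a = d + b\<close>, the gain \<open>a^2 + b^2 - (d^2 + b^2)\<close>
      equals \<open>a * b + d * b\<close>; the induction step consumes only the first
      summand.\<close>
    moreover have "0 \<le> c * (real d * real b)"
      using \<open>0 \<le> c\<close> by simp
    ultimately show ?thesis
      by (simp add: a algebra_simps power2_eq_square)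
  next
    case 3
    define d where "d = b - a"
    have b: "b = d + a"
      using 3 by (simp add: d_def)
    have "real a * L d - real d * L a \<le> c * ((real a)\<^sup>2 + (real d)\<^sup>2)"
      using 3 by (intro less) (simp add: b)
    moreover have "real a * (L b - L d - L a) \<le> real a * (c * real b)"
      using c[of d a] by (intro mult_left_mono) (auto simp: b)
    moreover have "0 \<le> c * (real d * real a)"
      using \<open>0 \<le> c\<close> by simp
    ultimately show ?thesis
      by (simp add: b algebra_simps power2_eq_square)
  qed
qed

text \<open>Splitting \<open>n\<close> into \<open>n - a\<close> and \<open>a\<close> releases
  \<open>\<tau> * L a\<close>, and splitting off \<open>b\<close> from \<open>\<beta> + b\<close>
  costs \<open>s * L b\<close>. The cross inequality shows that the release covers the cost up to an
  error linear in \<open>a\<close>; all errors are linear in \<open>n + \<beta>\<close> because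
  \<open>a \<le> n\<close> and \<open>b \<le> q * a\<close>.\<close>

lemma almost_additive_transfer:
  fixes L :: "nat \<Rightarrow> real"
  assumes c: "\<And>n k. \<bar>L (n + k) - L n - L k\<bar> \<le> c * real (n + k)" and L0: "L 0 = 0"
    and Lpos: "\<And>n. 0 \<le> L n"
    and s: "0 \<le> s" and \<tau>: "0 \<le> \<tau>"
    and ab: "a \<le> n" "b \<le> q * a" "s * real b \<le> \<tau> * real a"
  shows "\<tau> * L (n - a) + s * L (\<beta> + b) \<le>
    (\<tau> * c + s * c * (real q + 2 + (real q)\<^sup>2)) * real (n + \<beta>) + \<tau> * L n + s * L \<beta>"
proof -
  have c0: "0 \<le> c"
    using c[of 1 0] L0 by simp
  have qb: "real b \<le> real q * real a"
    using ab(2) by (metis of_nat_le_iff of_nat_mult)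
  \<comment> \<open>The cross inequality is multiplied by \<open>s\<close> and later divided by
    \<open>a\<close>; for \<open>a = 0\<close> the bound \<open>b \<le> q * a\<close> forces
    \<open>b = 0\<close>.\<close>
  have key: "s * L b \<le> \<tau> * L a + s * c * (1 + (real q)\<^sup>2) * real a"
  proof (cases "a = 0")
    case True
    then show ?thesis
      using ab L0 by simp
  next
    case False
    have "real a * (s * L b) = s * (real a * L b)"
      by simp
    also have "\<dots> \<le> s * (real b * L a + c * ((real a)\<^sup>2 + (real b)\<^sup>2))"
      using almost_additive_cross[OF c L0, of a b] s by (intro mult_left_mono) auto
    also have "\<dots> = s * real b * L a + s * c * ((real a)\<^sup>2 + (real b)\<^sup>2)"
      by (simp add: algebra_simps)
    \<comment> \<open>Since \<open>L a\<close> is nonnegative, the slope constraint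
      \<open>s * b \<le> \<tau> * a\<close> may be multiplied by it.\<close>
    also have "\<dots> \<le> \<tau> * real a * L a + s * c * ((real a)\<^sup>2 + (real q * real a)\<^sup>2)"
      using ab(3) Lpos s c0 qb by (intro add_mono mult_right_mono mult_left_mono power_mono) auto
    also have "\<dots> = real a * (\<tau> * L a + s * c * (1 + (real q)\<^sup>2) * real a)"
      by (simp add: algebra_simps power2_eq_square)
    finally show ?thesis
      using False by simp
  qed
  have 1: "\<tau> * (L (n - a) + L a) \<le> \<tau> * (L n + c * real n)"
    using c[of "n - a" a] ab(1) \<tau> by (intro mult_left_mono) auto
  have 2: "s * L (\<beta> + b) \<le> s * (L \<beta> + L b + c * real (\<beta> + b))"
    using c[of \<beta> b] s by (intro mult_left_mono) auto
  have 3: "s * c * (1 + (real q)\<^sup>2) * real a \<le> s * c * (1 + (real q)\<^sup>2) * real n"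
    using s c0 ab(1) by (intro mult_left_mono) auto
  have "real b \<le> real q * real n"
    using qb ab(1) by (meson mult_left_mono of_nat_0_le_iff of_nat_le_iff order_trans)
  then have 4: "s * c * real b \<le> s * c * (real q * real n)"
    using s c0 by (intro mult_left_mono) auto
  \<comment> \<open>This is exactly the slack between the collected errors and the stated multiple
    of \<open>n + \<beta>\<close>.\<close>
  have 5: "0 \<le> \<tau> * c * real \<beta> + s * c * (real q + 1 + (real q)\<^sup>2) * real \<beta> + s * c * real n"
    using s c0 \<tau> by simp
  show ?thesis
    using key 1 2 3 4 5 by (simp add: algebra_simps)
qed

text \<open>After taking logarithms, (mg) bounds the defect from above and (\<star>) from below.
  Absolute values enter the constant because \<open>B\<close> and \<open>b\<close> may lie on either
  side of 1.\<close>

lemma log_almost_additive: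
  assumes M: "\<And>n. 0 < M n" and "cond_mg M" "cond_star M"
  obtains c where "\<And>n k. \<bar>ln (M (n + k)) - ln (M n) - ln (M k)\<bar> \<le> c * real (n + k)"
proof -
  obtain B where B: "0 < B" "\<And>n k. M (n + k) \<le> B ^ (n + k) * M n * M k"
    using assms(2) by (auto simp: cond_mg_def)
  obtain b where b: "0 < b" "\<And>n k. b ^ (n + k) * M n * M k \<le> M (n + k)"
    using assms(3) by (auto simp: cond_star_def)
  have ln: "ln (x ^ (n + k) * M n * M k) = ln x * real (n + k) + ln (M n) + ln (M k)"
    if "0 < x" for x n k
    using that M by (simp add: ln_mult ln_realpow less_imp_neq[symmetric])
  have "\<bar>ln (M (n + k)) - ln (M n) - ln (M k)\<bar> \<le> max \<bar>ln B\<bar> \<bar>ln b\<bar> * real (n + k)" for n k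
  proof -
    have "ln (M (n + k)) \<le> ln B * real (n + k) + ln (M n) + ln (M k)"
      using B M by (metis ln ln_mono)
    moreover have "ln b * real (n + k) + ln (M n) + ln (M k) \<le> ln (M (n + k))"
      using b M by (metis ln ln_mono mult_pos_pos zero_less_power)
    moreover have "ln B * real (n + k) \<le> max \<bar>ln B\<bar> \<bar>ln b\<bar> * real (n + k)"
      "- ln b * real (n + k) \<le> max \<bar>ln B\<bar> \<bar>ln b\<bar> * real (n + k)"
      by (intro mult_right_mono; simp)+
    ultimately show ?thesis
      by linarith
  qed
  then show ?thesis
    by (rule that)
qed

section \<open>Moment derivatives and the formal solution\<close>

lemma fps_nth_mdiff_pow:
  assumes "\<And>n. 0 < m n"
  shows "fps_nth ((mdiff m ^^ k) g) n = of_real (m (n + k) / m n) * fps_nth g (n + k)"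
proof (induction k arbitrary: n)
  case (Suc k)
  then show ?case
    using assms[of "Suc n"] assms[of n] by (simp add: mdiff_def[of m "(mdiff m ^^ k) g"])
qed (use assms in \<open>simp add: less_imp_neq[symmetric]\<close>)

lemma fps_nth_mdiff_t_pow:
  assumes "\<And>n. 0 < m n"
  shows "fps_nth ((mdiff_t m ^^ k) u) n =
    fps_const (of_real (m (n + k) / m n)) * fps_nth u (n + k)"
proof (induction k arbitrary: n)
  case (Suc k)
  then show ?case
    using assms[of "Suc n"] assms[of n]
    by (simp add: mdiff_t_def[of m "(mdiff_t m ^^ k) u"] mult.assoc[symmetric])
qed (use assms in \<open>simp add: less_imp_neq[symmetric]\<close>)

lemma fps_nth_mdiff_z_pow: "fps_nth ((mdiff_z m ^^ k) u) n = (mdiff m ^^ k) (fps_nth u n)"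
  by (induction k) (simp_all add: mdiff_z_def)

definition scaled_coeff :: "(nat \<Rightarrow> real) \<Rightarrow> (nat \<Rightarrow> real) \<Rightarrow> complex fps fps \<Rightarrow> nat \<Rightarrow> nat \<Rightarrow> complex" where
  "scaled_coeff m0 m1 u n \<beta> = of_real (m0 n * m1 \<beta>) * fps_nth (fps_nth u n) \<beta>"

lemma scaled_coeff_cauchy_op:
  assumes m: "\<And>n. 0 < m0 n" "\<And>n. 0 < m1 n"
  shows "scaled_coeff m0 m1 (cauchy_op K P m0 m1 u) n \<beta> = scaled_coeff m0 m1 u (n + K) \<beta> -
    (\<Sum>j=1..K. \<Sum>\<alpha>\<le>degree (P j). coeff (P j) \<alpha> * scaled_coeff m0 m1 u (n + K - j) (\<beta> + \<alpha>))"
proof -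
  have m': "m0 n \<noteq> 0" "m1 n \<noteq> 0" for n
    using m[of n] by auto
  have "scaled_coeff m0 m1 (poly_op p (mdiff_z m1) ((mdiff_t m0 ^^ k) u)) n \<beta> =
      (\<Sum>\<alpha>\<le>degree p. coeff p \<alpha> * scaled_coeff m0 m1 u (n + k) (\<beta> + \<alpha>))" for p k
    unfolding scaled_coeff_def poly_op_def fps_sum_nth sum_distrib_left
    using m' by (intro sum.cong refl)
      (simp add: fps_nth_mdiff_z_pow fps_nth_mdiff_pow[OF m(2)] fps_nth_mdiff_t_pow[OF m(1)])
  moreover have "scaled_coeff m0 m1 ((mdiff_t m0 ^^ K) u) n \<beta> = scaled_coeff m0 m1 u (n + K) \<beta>"
    using m' by (simp add: scaled_coeff_def fps_nth_mdiff_t_pow[OF m(1)])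
  moreover have "scaled_coeff m0 m1 (cauchy_op K P m0 m1 u) n \<beta> =
    scaled_coeff m0 m1 ((mdiff_t m0 ^^ K) u) n \<beta> -
    (\<Sum>j=1..K. scaled_coeff m0 m1 (poly_op (P j) (mdiff_z m1) ((mdiff_t m0 ^^ (K - j)) u)) n \<beta>)"
    by (simp add: scaled_coeff_def cauchy_op_def fps_sum_nth algebra_simps sum_distrib_left)
  ultimately show ?thesis
    by simp
qed

lemma scaled_coeff_eq_iff:
  assumes m: "\<And>n. 0 < m0 n" "\<And>n. 0 < m1 n"
  shows "u = v \<longleftrightarrow> (\<forall>n \<beta>. scaled_coeff m0 m1 u n \<beta> = scaled_coeff m0 m1 v n \<beta>)"
  using m by (auto simp: scaled_coeff_def fps_eq_iff less_imp_neq[symmetric])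

text \<open>The initial conditions fix the rows below \<open>K\<close>, and the equation determines
  row \<open>n + K\<close> from earlier rows; the two branches of \<open>char_rec\<close> encode
  precisely this.\<close>

lemma formal_solution_iff:
  assumes m: "\<And>n. 0 < m0 n" "\<And>n. 0 < m1 n"
  shows "formal_solution K P m0 m1 f u \<longleftrightarrow>
    (\<forall>n \<beta>. scaled_coeff m0 m1 u n \<beta> = char_rec K P (scaled_coeff m0 m1 f) n \<beta>)"
proof -
  have m': "m0 n \<noteq> 0" "m1 n \<noteq> 0" for n
    using m[of n] by auto
  \<comment> \<open>At \<open>n = 0\<close> the \<open>j\<close>-th derivative is a nonzero multiple
    of the \<open>j\<close>-th coefficient of \<open>u\<close> in t.\<close>
  have init: "fps_nth ((mdiff_t m0 ^^ j) u) 0 = 0 \<longleftrightarrow> (\<forall>\<beta>. scaled_coeff m0 m1 u j \<beta> = 0)" for j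
    using m' by (simp add: fps_nth_mdiff_t_pow[OF m(1)] scaled_coeff_def fps_eq_iff)
  have eq: "cauchy_op K P m0 m1 u = f \<longleftrightarrow> (\<forall>n \<beta>. scaled_coeff m0 m1 u (n + K) \<beta> =
    scaled_coeff m0 m1 f n \<beta> +
    (\<Sum>j=1..K. \<Sum>\<alpha>\<le>degree (P j). coeff (P j) \<alpha> * scaled_coeff m0 m1 u (n + K - j) (\<beta> + \<alpha>)))"
    by (subst scaled_coeff_eq_iff[where ?m0.0 = m0 and ?m1.0 = m1])
      (simp_all add: m scaled_coeff_cauchy_op[OF m] algebra_simps)
  show ?thesis
  proof
    assume "formal_solution K P m0 m1 f u"
    then show "\<forall>n \<beta>. scaled_coeff m0 m1 u n \<beta> = char_rec K P (scaled_coeff m0 m1 f) n \<beta>"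
      by (auto simp: formal_solution_def init eq intro!: char_rec_unique)
  next
    assume u: "\<forall>n \<beta>. scaled_coeff m0 m1 u n \<beta> = char_rec K P (scaled_coeff m0 m1 f) n \<beta>"
    have "char_rec K P (scaled_coeff m0 m1 f) j \<beta> = 0" if "j < K" for j \<beta>
      using that by (simp add: char_rec.simps)
    moreover have "char_rec K P (scaled_coeff m0 m1 f) (n + K) \<beta> = scaled_coeff m0 m1 f n \<beta> +
      (\<Sum>j=1..K. \<Sum>\<alpha>\<le>degree (P j). coeff (P j) \<alpha> *
         char_rec K P (scaled_coeff m0 m1 f) (n + K - j) (\<beta> + \<alpha>))" for n \<beta>
      by (subst char_rec.simps) simp
    ultimately show "formal_solution K P m0 m1 f u"
      unfolding formal_solution_def init eq using u by simp
  qed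
qed

text \<open>This justifies speaking of the formal solution: dividing the recursion by the nonzero
  weights produces one, and the characterization leaves no other choice.\<close>

lemma ex1_formal_solution:
  assumes m: "\<And>n. 0 < m0 n" "\<And>n. 0 < m1 n"
  shows "\<exists>!u. formal_solution K P m0 m1 f u"
proof (rule ex_ex1I)
  have m': "m0 n \<noteq> 0" "m1 n \<noteq> 0" for n
    using m[of n] by auto
  define u where "u = Abs_fps (\<lambda>n. Abs_fps (\<lambda>\<beta>.
    char_rec K P (scaled_coeff m0 m1 f) n \<beta> / of_real (m0 n * m1 \<beta>)))"
  have "formal_solution K P m0 m1 f u"
    unfolding formal_solution_iff[OF m] using m' by (simp add: u_def scaled_coeff_def)
  then show "\<exists>u. formal_solution K P m0 m1 f u" ..
  fix u v assume "formal_solution K P m0 m1 f u" "formal_solution K P m0 m1 f v"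
  then show "u = v"
    by (intro iffD2[OF scaled_coeff_eq_iff[where ?m0.0 = m0 and ?m1.0 = m1]] m)
      (simp add: formal_solution_iff[OF m])
qed


section \<open>Growth conditions as coefficient estimates\<close>

text \<open>Cauchy's inequality gives the forward direction and a geometric series the converse. The
  radius of holomorphy is absorbed into a common exponential rate in \<open>n\<close> and
  \<open>\<beta>\<close>; the converse may return a different radius.\<close>

lemma fps_of_order_iff:
  assumes M: "\<And>n. 0 < M n"
  shows "fps_of_order M s g \<longleftrightarrow> (\<exists>A>0. \<exists>c. \<forall>n \<beta>.
    norm (fps_nth (fps_nth g n) \<beta>) \<le> A * exp (c * real (n + \<beta>)) * M n powr s)"
proof
  assume "fps_of_order M s g"
  then obtain R G where R: "0 < R"
    and G: "\<And>n. G n holomorphic_on ball 0 R" "\<And>n. G n has_fps_expansion fps_nth g n"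
    and bd: "\<And>r. \<lbrakk>0 < r; r < R\<rbrakk> \<Longrightarrow>
      \<exists>A>0. \<exists>B>0. \<forall>n. \<forall>z\<in>ball 0 r. norm (G n z) \<le> A * B ^ n * M n powr s"
    unfolding fps_of_order_def by blast
  obtain A B where AB: "0 < A" "0 < B"
    "\<And>n z. z \<in> ball 0 (R / 2) \<Longrightarrow> norm (G n z) \<le> A * B ^ n * M n powr s"
    using bd[of "R / 2"] R by auto
  \<comment> \<open>The closed disc of radius \<open>R / 4\<close> lies inside the ball of radius
    \<open>R / 2\<close> on which the bound is available.\<close>
  define \<rho> where "\<rho> = R / 4"
  define c where "c = max (ln B) (- ln \<rho>)"
  have \<rho>: "0 < \<rho>" "\<rho> < R / 2"
    using R by (auto simp: \<rho>_def)
  have "norm (fps_nth (fps_nth g n) \<beta>) \<le> A * exp (c * real (n + \<beta>)) * M n powr s" for n \<beta>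
  proof -
    have "norm ((deriv ^^ \<beta>) (G n) 0) \<le> fact \<beta> * (A * B ^ n * M n powr s) / \<rho> ^ \<beta>"
    proof (rule Cauchy_inequality)
      show "G n holomorphic_on ball 0 \<rho>"
        using G(1) by (rule holomorphic_on_subset) (use \<rho> R in auto)
      have "G n holomorphic_on cball 0 \<rho>"
        using G(1) by (rule holomorphic_on_subset) (use \<rho> R in auto)
      then show "continuous_on (cball 0 \<rho>) (G n)"
        by (rule holomorphic_on_imp_continuous_on)
    qed (use \<rho> AB(3) in auto)
    then have "norm (fps_nth (fps_nth g n) \<beta>) \<le> A * (B ^ n * inverse \<rho> ^ \<beta>) * M n powr s"
      by (simp add: fps_nth_fps_expansion[OF G(2)] norm_divide field_simps)
    also have "\<dots> \<le> A * exp (c * real (n + \<beta>)) * M n powr s"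
    proof (intro mult_right_mono mult_left_mono)
      have "B ^ n * inverse \<rho> ^ \<beta> = exp (ln B * real n + - ln \<rho> * real \<beta>)"
        using AB(2) \<rho>(1) unfolding exp_add exp_of_nat2_mult by (simp add: exp_minus)
      also have "\<dots> \<le> exp (c * real n + c * real \<beta>)"
        unfolding exp_le_cancel_iff c_def by (intro add_mono mult_right_mono) auto
      finally show "B ^ n * inverse \<rho> ^ \<beta> \<le> exp (c * real (n + \<beta>))"
        by (simp add: algebra_simps)
    qed (use AB(1) in auto)
    finally show ?thesis .
  qed
  then show "\<exists>A>0. \<exists>c. \<forall>n \<beta>. norm (fps_nth (fps_nth g n) \<beta>) \<le> A * exp (c * real (n + \<beta>)) * M n powr s"
    using AB(1) by blast
next
  assume "\<exists>A>0. \<exists>c. \<forall>n \<beta>. norm (fps_nth (fps_nth g n) \<beta>) \<le> A * exp (c * real (n + \<beta>)) * M n powr s"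
  then obtain A c where A: "0 < A"
    and bd: "\<And>n \<beta>. norm (fps_nth (fps_nth g n) \<beta>) \<le> A * exp (c * real (n + \<beta>)) * M n powr s"
    by blast
  \<comment> \<open>Half of \<open>exp (- c)\<close>, so that the series in \<open>z\<close> is
    dominated by a geometric series of ratio 1/2.\<close>
  define R where "R = exp (- c) / 2"
  define N where "N n = A * exp c ^ n * M n powr s" for n
  have N: "0 \<le> N n" for n
    using A by (simp add: N_def)
  have R: "0 < R"
    by (simp add: R_def)
  have term_le: "norm (fps_nth (fps_nth g n) \<beta> * z ^ \<beta>) \<le> N n * (1 / 2) ^ \<beta>"
    if z: "norm z \<le> R" for n \<beta> z
  proof -
    have "norm (fps_nth (fps_nth g n) \<beta> * z ^ \<beta>) \<le>
        (A * exp (c * real (n + \<beta>)) * M n powr s) * R ^ \<beta>"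
      unfolding norm_mult norm_power using bd z A by (intro mult_mono power_mono) auto
    also have "exp (c * real (n + \<beta>)) = exp c ^ n * exp c ^ \<beta>"
      by (simp add: exp_add distrib_left exp_of_nat2_mult)
    also have "(A * (exp c ^ n * exp c ^ \<beta>) * M n powr s) * R ^ \<beta> = N n * (exp c * R) ^ \<beta>"
      by (simp add: N_def power_mult_distrib)
    also have "exp c * R = 1 / 2"
      by (simp add: R_def exp_minus)
    finally show ?thesis .
  qed
  have sums: "(\<lambda>\<beta>. N n * (1 / 2) ^ \<beta>) sums (N n * 2)" for n
    using geometric_sums[of "1 / 2 :: real"] by (intro sums_mult) simp
  have summ: "summable (\<lambda>\<beta>. norm (fps_nth (fps_nth g n) \<beta> * z ^ \<beta>))" if "norm z \<le> R" for n z
    by (rule summable_comparison_test'[OF sums_summable[OF sums[of n]], of 0])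
      (use term_le[OF that] in auto)
  have rad: "ereal R \<le> fps_conv_radius (fps_nth g n)" for n
  proof -
    have "summable (\<lambda>\<beta>. fps_nth (fps_nth g n) \<beta> * of_real R ^ \<beta>)"
      using R by (intro summable_norm_cancel[OF summ]) simp
    then show ?thesis
      unfolding fps_conv_radius_def using conv_radius_geI R by fastforce
  qed
  have le: "norm (eval_fps (fps_nth g n) z) \<le> (A * 2) * exp c ^ n * M n powr s"
    if z: "norm z \<le> R" for n z
  proof -
    have "norm (eval_fps (fps_nth g n) z) \<le> (\<Sum>\<beta>. norm (fps_nth (fps_nth g n) \<beta> * z ^ \<beta>))"
      unfolding eval_fps_def by (rule summable_norm[OF summ[OF z]])
    also have "\<dots> \<le> (\<Sum>\<beta>. N n * (1 / 2) ^ \<beta>)"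
      by (intro suminf_le summ z term_le sums_summable[OF sums])
    also have "\<dots> = N n * 2"
      by (rule sums_unique[OF sums, symmetric])
    finally show ?thesis
      by (simp add: N_def algebra_simps)
  qed
  have hol: "eval_fps (fps_nth g n) holomorphic_on ball 0 R" for n
    by (rule holomorphic_on_eval_fps) (auto simp: in_eball_iff intro!: less_le_trans[OF _ rad])
  have expn: "eval_fps (fps_nth g n) has_fps_expansion fps_nth g n" for n
    unfolding has_fps_expansion_def using R by (auto intro: less_le_trans[OF _ rad])
  have bound: "\<exists>A>0. \<exists>B>0. \<forall>n. \<forall>z\<in>ball 0 r. norm (eval_fps (fps_nth g n) z) \<le> A * B ^ n * M n powr s"
    if "r < R" for r
    using A le that by (intro exI[of _ "A * 2"] conjI exI[of _ "exp c"]) auto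
  show "fps_of_order M s g"
    unfolding fps_of_order_def
    by (rule exI[of _ R], rule conjI[OF R], rule exI[of _ "\<lambda>n. eval_fps (fps_nth g n)"])
      (use hol expn bound in simp)
qed

text \<open>A single nonnegative rate for both bounds reduces later estimates to adding
  exponents.\<close>

lemma seq_of_order_exp_bounds:
  assumes "seq_of_order M s m" and M: "\<And>n. 0 < M n"
  obtains c where "0 \<le> c" "\<And>n. m n \<le> exp (c * real n + s * ln (M n))"
    "\<And>n. exp (s * ln (M n) - c * real n) \<le> m n"
proof -
  obtain a A where aA: "0 < a" "0 < A"
    "\<And>n. a ^ n * M n powr s \<le> m n" "\<And>n. m n \<le> A ^ n * M n powr s"
    using assms(1) by (auto simp: seq_of_order_def)
  define c where "c = max \<bar>ln a\<bar> \<bar>ln A\<bar>"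
  have pow: "x ^ n * M n powr s = exp (ln x * real n + s * ln (M n))" if "0 < x" for x n
    using that M[of n] by (simp add: powr_def exp_add exp_of_nat2_mult)
  show ?thesis
  proof (rule that)
    show "0 \<le> c"
      by (simp add: c_def)
    fix n
    have "ln A * real n \<le> c * real n" "- ln a * real n \<le> c * real n"
      unfolding c_def by (intro mult_right_mono; simp)+
    then have "exp (ln A * real n + s * ln (M n)) \<le> exp (c * real n + s * ln (M n))"
      "exp (s * ln (M n) - c * real n) \<le> exp (ln a * real n + s * ln (M n))"
      by auto
    then show "m n \<le> exp (c * real n + s * ln (M n))" "exp (s * ln (M n) - c * real n) \<le> m n"
      using aA(3)[of n] aA(4)[of n] unfolding pow[OF aA(1)] pow[OF aA(2)] by linarith+
  qed
qed

text \<open>\<open>P j\<close> multiplies the derivative of order \<open>K - j\<close> in t, so its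
  terms contribute the quotients \<open>(s1 * \<alpha> - s0 * j) / j\<close> to the maximum that
  equals \<open>1 / k1\<close>.\<close>

lemma op_support_slope_bound:
  assumes "first_positive_slope (newton_polygon s0 s1 K P) k1"
    and "j \<in> {1..K}" "coeff (P j) \<alpha> \<noteq> 0"
  shows "s1 * real \<alpha> \<le> (s0 + 1 / k1) * real j"
proof -
  define h where "h = (\<lambda>(j, \<alpha>). (s0 * (real j - real K) + s1 * real \<alpha>) / (real K - real j))"
  have "(K - j, \<alpha>) \<in> op_support K P"
    using assms(2,3) by (auto simp: op_support_def)
  then have "h (K - j, \<alpha>) \<le> Max (insert 0 (h ` op_support K P))"
    using finite_op_support by (intro Max_ge) auto
  also have "\<dots> = 1 / k1"
    using assms(1) by (simp add: first_positive_slope_newton_polygon h_def)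
  finally show ?thesis
    using assms(2) by (simp add: h_def of_nat_diff field_simps)
qed

section \<open>The growth estimate for the formal solution\<close>

theorem theorem2:
  fixes M m0 m1 :: "nat \<Rightarrow> real" and s0 s1 k1 :: real
    and K :: nat and P :: "nat \<Rightarrow> complex poly" and f :: "complex fps fps"
  assumes "\<And>n. 0 < M n" and "M 0 = 1" and "incseq M"
    and "cond_mg M" and "cond_star M"
    and "0 \<le> s0" and "0 \<le> s1"
    and "seq_of_order M s0 m0" and "seq_of_order M s1 m1"
    and "1 \<le> K"
    and "first_positive_slope (newton_polygon s0 s1 K P) k1" and "0 < 1 / k1"
    and "fps_of_order M (1 / k1) f"
  shows "(\<exists>!u. formal_solution K P m0 m1 f u) \<and>
         (\<forall>u. formal_solution K P m0 m1 f u \<longrightarrow> fps_of_order M (1 / k1) u)"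
proof (intro conjI allI impI)
  have m: "0 < m0 n" "0 < m1 n" for n
    using assms(8,9) by (auto simp: seq_of_order_def)
  show "\<exists>!u. formal_solution K P m0 m1 f u"
    using m by (rule ex1_formal_solution)
  fix u assume u: "formal_solution K P m0 m1 f u"
  define \<sigma> \<tau> L where "\<sigma> = 1 / k1" and "\<tau> = s0 + \<sigma>" and "L n = ln (M n)" for n
  have \<tau>: "0 \<le> \<tau>"
    using assms(6,12) by (simp add: \<tau>_def \<sigma>_def)
  have L0: "L 0 = 0"
    by (simp add: L_def assms(2))
  \<comment> \<open>Monotonicity and \<open>M 0 = 1\<close> make the logarithms nonnegative, as the
    transfer estimate requires.\<close>
  have Lpos: "0 \<le> L n" for n
    using incseqD[OF assms(3), of 0 n] assms(2) by (simp add: L_def)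
  have Mpow: "M n powr \<sigma> = exp (\<sigma> * L n)" for n
    using assms(1)[of n] by (simp add: powr_def L_def)
  obtain c where c: "\<And>n k. \<bar>L (n + k) - L n - L k\<bar> \<le> c * real (n + k)"
    unfolding L_def using log_almost_additive[OF assms(1,4,5)] by blast
  obtain c0 where c0: "0 \<le> c0" "\<And>n. m0 n \<le> exp (c0 * real n + s0 * L n)"
    "\<And>n. exp (s0 * L n - c0 * real n) \<le> m0 n"
    unfolding L_def using seq_of_order_exp_bounds[OF assms(8,1)] by blast
  obtain c1 where c1: "0 \<le> c1" "\<And>n. m1 n \<le> exp (c1 * real n + s1 * L n)"
    "\<And>n. exp (s1 * L n - c1 * real n) \<le> m1 n"
    unfolding L_def using seq_of_order_exp_bounds[OF assms(9,1)] by blast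
  obtain A cf where A: "0 < A"
    and f: "\<And>n \<beta>. norm (fps_nth (fps_nth f n) \<beta>) \<le> A * exp (cf * real (n + \<beta>)) * M n powr \<sigma>"
    using assms(13) unfolding fps_of_order_iff[OF assms(1)] \<sigma>_def by blast
  define d where "d = \<bar>cf\<bar> + c0 + c1"
  have d: "0 \<le> d"
    using c0 c1 by (simp add: d_def)
  \<comment> \<open>An envelope for the scaled right-hand side: \<open>\<tau>\<close> combines
    \<open>s0\<close> from \<open>m0\<close> with the order \<open>\<sigma>\<close> of
    \<open>f\<close>, and \<open>s1\<close> comes from \<open>m1\<close>. The rate \<open>d\<close>
    collects all geometric factors.\<close>
  define w where "w n \<beta> = exp (d * real (n + \<beta>) + \<tau> * L n + s1 * L \<beta>)" for n \<beta>
  define Q where "Q = 1 + (\<Sum>j=1..K. \<Sum>\<alpha>\<le>degree (P j). norm (coeff (P j) \<alpha>))"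
  \<comment> \<open>A crude bound on the z-order of each step. It controls \<open>b\<close> also
    when \<open>s1 = 0\<close>, where the slope condition says nothing about
    \<open>b\<close>.\<close>
  define q where "q = (\<Sum>j=1..K. degree (P j))"
  have Q: "1 \<le> Q"
    unfolding Q_def by (simp add: sum_nonneg)
  have F: "norm (scaled_coeff m0 m1 f n \<beta>) \<le> A * w n \<beta>" for n \<beta>
  proof -
    have "norm (scaled_coeff m0 m1 f n \<beta>) = m0 n * m1 \<beta> * norm (fps_nth (fps_nth f n) \<beta>)"
      using m[of n] m[of \<beta>] by (simp add: scaled_coeff_def norm_mult)
    also have "\<dots> \<le> exp (c0 * real n + s0 * L n) * exp (c1 * real \<beta> + s1 * L \<beta>) *
        (A * exp (cf * real (n + \<beta>)) * M n powr \<sigma>)"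
      using c0 c1 f m by (intro mult_mono) (auto intro: less_imp_le)
    also have "\<dots> = A * exp (c0 * real n + c1 * real \<beta> + cf * real (n + \<beta>) + \<tau> * L n + s1 * L \<beta>)"
      by (simp add: Mpow \<tau>_def exp_add distrib_right)
    also have "\<dots> \<le> A * w n \<beta>"
    proof -
      have "c0 * real n \<le> c0 * real (n + \<beta>)" "c1 * real \<beta> \<le> c1 * real (n + \<beta>)"
        "cf * real (n + \<beta>) \<le> \<bar>cf\<bar> * real (n + \<beta>)"
        using c0(1) c1(1) by (auto intro!: mult_left_mono mult_right_mono)
      then have "c0 * real n + c1 * real \<beta> + cf * real (n + \<beta>) \<le> d * real (n + \<beta>)"
        unfolding d_def distrib_right by linarith
      then show ?thesis
        using A by (simp add: w_def)
    qed
    finally show ?thesis .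
  qed
  have supp: "\<alpha> \<le> q * j \<and> s1 * real \<alpha> \<le> \<tau> * real j"
    if "j \<in> {1..K}" "coeff (P j) \<alpha> \<noteq> 0" for j \<alpha>
  proof
    have "\<alpha> \<le> degree (P j)"
      by (rule le_degree[OF that(2)])
    also have "\<dots> \<le> q"
      unfolding q_def using that(1) by (intro member_le_sum) auto
    also have "\<dots> \<le> q * j"
      using that(1) by simp
    finally show "\<alpha> \<le> q * j" .
    show "s1 * real \<alpha> \<le> \<tau> * real j"
      using op_support_slope_bound[OF assms(11) that] by (simp add: \<tau>_def \<sigma>_def)
  qed
  \<comment> \<open>The first summand comes from
    \<open>n - a + \<beta> + b \<le> (1 + q) * (n + \<beta>)\<close>, the second from the transfer
    estimate.\<close>
  define e where "e = d * (1 + real q) + (\<tau> * c + s1 * c * (real q + 2 + (real q)\<^sup>2))"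
  have V: "w (n - a) (\<beta> + b) \<le> exp (e * real (n + \<beta>) + \<tau> * L n + s1 * L \<beta>)"
    if ab: "a \<le> n" "b \<le> q * a" "s1 * real b \<le> \<tau> * real a" for n \<beta> a b
  proof -
    have "b \<le> q * n"
      using ab by (meson le_trans mult_le_mono2)
    then have "real (n - a + (\<beta> + b)) \<le> real (n + \<beta> + q * n + q * \<beta>)"
      unfolding of_nat_le_iff by simp
    then have "d * real (n - a + (\<beta> + b)) \<le> d * ((1 + real q) * real (n + \<beta>))"
      using d by (intro mult_left_mono) (simp_all add: algebra_simps)
    then show ?thesis
      using almost_additive_transfer[OF c L0 Lpos assms(7) \<tau> ab, of \<beta>]
      unfolding w_def exp_le_cancel_iff e_def by (simp add: algebra_simps)
  qed
  have "norm (fps_nth (fps_nth u n) \<beta>) \<le> A * exp ((ln Q + \<bar>e\<bar> + c0 + c1) * real (n + \<beta>)) * M n powr \<sigma>"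
    for n \<beta>
  proof -
    have "norm (scaled_coeff m0 m1 u n \<beta>) = norm (char_rec K P (scaled_coeff m0 m1 f) n \<beta>)"
      using u m by (simp add: formal_solution_iff)
    also have "\<dots> \<le> A * Q ^ n * exp (e * real (n + \<beta>) + \<tau> * L n + s1 * L \<beta>)"
      by (rule char_rec_bound[where w = w and s = s1 and \<tau> = \<tau> and q = q])
        (use A F supp \<tau> assms(10) V in \<open>auto simp: w_def Q_def\<close>)
    also have "Q ^ n = exp (ln Q * real n)"
      using Q by (simp add: exp_of_nat2_mult)
    finally have U: "norm (scaled_coeff m0 m1 u n \<beta>) \<le>
      A * exp (ln Q * real n + e * real (n + \<beta>) + \<tau> * L n + s1 * L \<beta>)"
      by (simp add: exp_add mult.assoc)
    \<comment> \<open>Undoing the scaling with the lower bounds on \<open>m0\<close> and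
      \<open>m1\<close> cancels \<open>s1 * L \<beta>\<close> and reduces
      \<open>\<tau> * L n\<close> to \<open>\<sigma> * L n\<close>, leaving the required
      order.\<close>
    have "exp (s0 * L n - c0 * real n + (s1 * L \<beta> - c1 * real \<beta>)) * norm (fps_nth (fps_nth u n) \<beta>)
        \<le> m0 n * m1 \<beta> * norm (fps_nth (fps_nth u n) \<beta>)"
      unfolding exp_add using c0 c1 m by (intro mult_right_mono mult_mono) (auto intro: less_imp_le)
    also have "\<dots> = norm (scaled_coeff m0 m1 u n \<beta>)"
      using m[of n] m[of \<beta>] by (simp add: scaled_coeff_def norm_mult)
    finally have "norm (fps_nth (fps_nth u n) \<beta>) \<le>
      A * exp (ln Q * real n + e * real (n + \<beta>) + \<tau> * L n + s1 * L \<beta>) /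
      exp (s0 * L n - c0 * real n + (s1 * L \<beta> - c1 * real \<beta>))"
      using U by (simp add: pos_le_divide_eq mult.commute)
    also have "\<dots> = A * exp (ln Q * real n + e * real (n + \<beta>) + c0 * real n + c1 * real \<beta> + \<sigma> * L n)"
      unfolding times_divide_eq_right[symmetric] exp_diff[symmetric]
      by (simp add: \<tau>_def algebra_simps)
    also have "\<dots> \<le> A * exp ((ln Q + \<bar>e\<bar> + c0 + c1) * real (n + \<beta>) + \<sigma> * L n)"
    proof -
      have "ln Q * real n \<le> ln Q * real (n + \<beta>)" "c0 * real n \<le> c0 * real (n + \<beta>)"
        "c1 * real \<beta> \<le> c1 * real (n + \<beta>)" "e * real (n + \<beta>) \<le> \<bar>e\<bar> * real (n + \<beta>)"
        using Q c0(1) c1(1) by (auto intro!: mult_left_mono mult_right_mono)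
      then show ?thesis
        using A unfolding distrib_right by simp
    qed
    also have "\<dots> = A * exp ((ln Q + \<bar>e\<bar> + c0 + c1) * real (n + \<beta>)) * M n powr \<sigma>"
      by (simp add: Mpow exp_add)
    finally show ?thesis .
  qed
  then show "fps_of_order M (1 / k1) u"
    unfolding fps_of_order_iff[OF assms(1)] \<sigma>_def[symmetric] using A by blast
qed

end
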